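(* Let $n\ge4$ and let $S$ be a cyclic strategy of length $n$. Then exactly one permutation $\pi\in S_n$ has the property that the game with strategy $S$ and secret $\pi$ ends after exactly three guesses and $\rho_S(\pi)=3$.
   Context: Permutation wordle on $[n]=\{1,\dots,n\}$: a secret permutation $\pi\in S_n$ (one-line notation) is fixed. The first guess is $\gamma_1=[1,2,\dots,n]$. After guess $\gamma_r$ the guesser learns $\mathcal{J}_r=\{i:\gamma_r(i)=\pi(i)\}$; $\mathcal{I}_r=[n]\setminus\mathcal{J}_r$. The game ends at the first $r$ with $\mathcal{J}_r=[n]$. A strategy of length $n$ is a sequence $S=(S[1],\dots,S[n])$ with $S[k]$ a permutation of $[k]$; if $\mathcal{I}_r=\{i_1<\dots<i_k\}\neq\emptyset$ and $\sigma=S[k]$, then $\gamma_{r+1}(i)=\gamma_r(i)$ for $i\in\mathcal{J}_r$ and $\gamma_{r+1}(i_{\sigma(j)})=\gamma_r(i_j)$ for $j=1,\dots,k$. A cyclic strategy is one in which every component $S[k]$ is a cyclic permutation of $[k]$ (a single $k$-cycle). For a secret $\pi$, $\rho_S(\pi)=\min\{i:\mathcal{J}_i\neq\emptyset\}$. *)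

theory Defs
  imports "HOL-Combinatorics.Permutations" "HOL-Combinatorics.Orbits"
begin

text \<open>
  Permutations of \<open>[n]\<close> (secrets, guesses, strategy components) are functions on \<^typ>\<open>nat\<close> that
  permute \<open>{1..n}\<close> and are the identity elsewhere. A strategy of length \<open>n\<close> is a function on
  \<^typ>\<open>nat\<close> of which only the values at \<open>1, ..., n\<close> matter.
\<close>

definition strategy :: "nat \<Rightarrow> (nat \<Rightarrow> nat \<Rightarrow> nat) \<Rightarrow> bool" where
  "strategy n S \<longleftrightarrow> (\<forall>k\<in>{1..n}. S k permutes {1..k})"

definition cyclic_strategy :: "nat \<Rightarrow> (nat \<Rightarrow> nat \<Rightarrow> nat) \<Rightarrow> bool" where
  "cyclic_strategy n S \<longleftrightarrow> strategy n S \<and> (\<forall>k\<in>{1..n}. cyclic_on (S k) {1..k})"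

definition agreement :: "nat \<Rightarrow> (nat \<Rightarrow> nat) \<Rightarrow> (nat \<Rightarrow> nat) \<Rightarrow> nat set" where
  "agreement n \<pi> \<gamma> = {i \<in> {1..n}. \<gamma> i = \<pi> i}"

definition disagreement :: "nat \<Rightarrow> (nat \<Rightarrow> nat) \<Rightarrow> (nat \<Rightarrow> nat) \<Rightarrow> nat set" where
  "disagreement n \<pi> \<gamma> = {1..n} - agreement n \<pi> \<gamma>"

text \<open>The \<open>j\<close>-th smallest element \<open>i\<^sub>j\<close> of a finite set, counted from \<open>j = 1\<close>.\<close>

definition nth_elem :: "nat set \<Rightarrow> nat \<Rightarrow> nat" where
  "nth_elem I j = sorted_list_of_set I ! (j - 1)"

text \<open>
  The entry of \<open>\<gamma>\<close> at position \<open>i\<^sub>j\<close> moves to position \<open>i\<^bsub>\<sigma>(j)\<^esub>\<close>. So the new entry at a position \<open>i\<close>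
  of disagreement is found by solving \<open>i\<^bsub>\<sigma>(j)\<^esub> = i\<close> for \<open>j\<close>; the lemma \<open>next_guess_moved\<close> below
  recovers the rule in its usual form.
\<close>

definition next_guess ::
    "(nat \<Rightarrow> nat \<Rightarrow> nat) \<Rightarrow> nat \<Rightarrow> (nat \<Rightarrow> nat) \<Rightarrow> (nat \<Rightarrow> nat) \<Rightarrow> nat \<Rightarrow> nat" where
  "next_guess S n \<pi> \<gamma> i =
    (let I = disagreement n \<pi> \<gamma>; k = card I; \<sigma> = S k
     in if i \<in> I then \<gamma> (nth_elem I (inv_into {1..k} (\<lambda>j. nth_elem I (\<sigma> j)) i)) else \<gamma> i)"

text \<open>
  Guesses are numbered from 1. Once the secret has been guessed, the sequence stays constant.
\<close>

definition guess :: "(nat \<Rightarrow> nat \<Rightarrow> nat) \<Rightarrow> nat \<Rightarrow> (nat \<Rightarrow> nat) \<Rightarrow> nat \<Rightarrow> nat \<Rightarrow> nat" where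
  "guess S n \<pi> r = (next_guess S n \<pi> ^^ (r - 1)) id"

definition ends_after :: "(nat \<Rightarrow> nat \<Rightarrow> nat) \<Rightarrow> nat \<Rightarrow> (nat \<Rightarrow> nat) \<Rightarrow> nat \<Rightarrow> bool" where
  "ends_after S n \<pi> r \<longleftrightarrow>
    1 \<le> r \<and> agreement n \<pi> (guess S n \<pi> r) = {1..n} \<and>
    (\<forall>q. 1 \<le> q \<and> q < r \<longrightarrow> agreement n \<pi> (guess S n \<pi> q) \<noteq> {1..n})"

text \<open>
  The number \<open>\<rho>\<^sub>S(\<pi>)\<close>; it is unspecified if no guess ever has a correct entry.
\<close>

definition first_hit :: "(nat \<Rightarrow> nat \<Rightarrow> nat) \<Rightarrow> nat \<Rightarrow> (nat \<Rightarrow> nat) \<Rightarrow> nat" where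
  "first_hit S n \<pi> = (LEAST r. 1 \<le> r \<and> agreement n \<pi> (guess S n \<pi> r) \<noteq> {})"

lemma guess_1: "guess S n \<pi> 1 = id"
  by (simp add: guess_def)

lemma guess_Suc:
  assumes "1 \<le> r"
  shows "guess S n \<pi> (Suc r) = next_guess S n \<pi> (guess S n \<pi> r)"
  using assms by (cases r) (simp_all add: guess_def)

lemma finite_disagreement [simp]: "finite (disagreement n \<pi> \<gamma>)"
  by (simp add: disagreement_def)

lemma card_disagreement_le: "card (disagreement n \<pi> \<gamma>) \<le> n"
  using card_mono[of "{1..n}" "disagreement n \<pi> \<gamma>"] by (auto simp: disagreement_def)

lemma nth_elem_mem:
  assumes "finite I" "j \<in> {1..card I}"
  shows "nth_elem I j \<in> I"
proof -
  have "j - 1 < length (sorted_list_of_set I)"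
    using assms(2) by auto
  then have "sorted_list_of_set I ! (j - 1) \<in> set (sorted_list_of_set I)"
    by (rule nth_mem)
  then show ?thesis
    using assms(1) by (simp add: nth_elem_def)
qed

lemma inj_on_nth_elem:
  assumes "finite I"
  shows "inj_on (nth_elem I) {1..card I}"
proof (rule inj_onI)
  fix x y
  assume x: "x \<in> {1..card I}" and y: "y \<in> {1..card I}" and eq: "nth_elem I x = nth_elem I y"
  have "x - 1 < length (sorted_list_of_set I)" "y - 1 < length (sorted_list_of_set I)"
    using x y by auto
  then have "x - 1 = y - 1"
    using eq nth_eq_iff_index_eq[OF distinct_sorted_list_of_set] unfolding nth_elem_def by blast
  then show "x = y"
    using x y by auto
qed

lemma next_guess_kept:
  assumes "i \<notin> disagreement n \<pi> \<gamma>"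
  shows "next_guess S n \<pi> \<gamma> i = \<gamma> i"
  using assms by (simp add: next_guess_def Let_def)

lemma next_guess_moved:
  assumes "strategy n S"
    and I: "I = disagreement n \<pi> \<gamma>"
    and j: "j \<in> {1..card I}"
  shows "next_guess S n \<pi> \<gamma> (nth_elem I (S (card I) j)) = \<gamma> (nth_elem I j)"
proof -
  let ?k = "card I"
  have fin: "finite I"
    by (simp add: I)
  have "?k \<in> {1..n}"
    using j card_disagreement_le[of n \<pi> \<gamma>] by (auto simp: I)
  then have p: "S ?k permutes {1..?k}"
    using assms(1) by (auto simp: strategy_def)
  have "inj_on (nth_elem I \<circ> S ?k) {1..?k}"
    using inj_on_nth_elem[OF fin] by (intro comp_inj_on permutes_inj_on[OF p]) (simp only: permutes_image[OF p])
  then have inj: "inj_on (\<lambda>j. nth_elem I (S ?k j)) {1..?k}"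
    by (simp add: comp_def)
  have "S ?k j \<in> {1..?k}"
    using permutes_in_image[OF p] j by blast
  then have "nth_elem I (S ?k j) \<in> I"
    using nth_elem_mem fin by blast
  then show ?thesis
    unfolding next_guess_def Let_def I[symmetric] using inv_into_f_f[OF inj j] by simp
qed

end

theory Submission
  imports Defs
begin

text \<open>
  As long as no entry has been correct, each step composes the guess with the inverse of
  \<open>\<sigma> = S n\<close>, so a secret that is first hit, and completely, by the third guess can only be
  \<open>\<sigma>\<inverse> \<circ> \<sigma>\<inverse>\<close>. An \<open>n\<close>-cycle with \<open>n \<ge> 3\<close> has no point of period 1 or 2, so for this secret
  the first two guesses are indeed wrong everywhere.
\<close>

text \<open>If \<open>f (f x) = x\<close>, iteration from \<open>x\<close> never leaves
  \<open>{x, f x}\<close>, while on a cycle the orbit of \<open>x\<close> is all of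
  \<open>A\<close>. Fixed points are excluded too, since they satisfy the same equation.\<close>

lemma cyclic_on_no_period_two:
  assumes "cyclic_on f A" "card A \<ge> 3" "x \<in> A"
  shows "f (f x) \<noteq> x"
proof
  assume period: "f (f x) = x"
  have "orbit f x \<subseteq> {x, f x}"
  proof
    fix y assume "y \<in> orbit f x"
    then show "y \<in> {x, f x}"
      by induction (use period in auto)
  qed
  moreover have "orbit f x = A"
    using assms(1,3) by (simp add: cyclic_on_alldef)
  ultimately have "card A \<le> card {x, f x}"
    by (simp add: card_mono)
  also have "\<dots> \<le> 2"
    by (simp add: card_insert_if)
  finally show False
    using assms(2) by simp
qed

lemma nth_elem_interval:
  assumes "j \<in> {1..n}"
  shows "nth_elem {1..n} j = j"
proof -
  have "sorted_list_of_set {1..n} = [1..<Suc n]"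
    by (metis atLeastLessThanSuc_atLeastAtMost sorted_list_of_set_range)
  then show ?thesis
    using assms by (auto simp: nth_elem_def simp del: upt_Suc)
qed

text \<open>With no correct entry the positions to be permuted are all of \<open>{1..n}\<close>,
  whose increasing enumeration is the identity. The entry at \<open>j\<close> thus moves to
  \<open>S n j\<close>; reading this off at the target position produces the inverse. Outside the
  interval \<open>inv (S n)\<close> fixes \<open>i\<close>.\<close>

lemma next_guess_no_agreement:
  assumes S: "strategy n S" and "n \<ge> 1" and none: "agreement n \<pi> \<gamma> = {}"
  shows "next_guess S n \<pi> \<gamma> = \<gamma> \<circ> inv (S n)"
proof
  fix i
  have perm: "S n permutes {1..n}"
    using S \<open>n \<ge> 1\<close> by (auto simp: strategy_def)
  have dis: "disagreement n \<pi> \<gamma> = {1..n}"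
    using none by (simp add: disagreement_def)
  show "next_guess S n \<pi> \<gamma> i = (\<gamma> \<circ> inv (S n)) i"
  proof (cases "i \<in> {1..n}")
    case True
    define j where "j = inv (S n) i"
    have i: "i = S n j"
      unfolding j_def using permutes_inverses(1)[OF perm] by simp
    have j: "j \<in> {1..n}"
      using permutes_in_image[OF perm] True i by blast
    have "next_guess S n \<pi> \<gamma> (nth_elem {1..n} (S n j)) = \<gamma> (nth_elem {1..n} j)"
      using next_guess_moved[OF S dis[symmetric], of j] j by simp
    then show ?thesis
      using nth_elem_interval[OF j] nth_elem_interval[OF True] i[symmetric]
      by (simp add: j_def[symmetric])
  next
    case False
    then show ?thesis
      using next_guess_kept[of i n \<pi> \<gamma> S] permutes_not_in[OF permutes_inv[OF perm] False]
      by (simp add: dis)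
  qed
qed

lemma guess_2:
  assumes "strategy n S" "n \<ge> 1" "agreement n \<pi> id = {}"
  shows "guess S n \<pi> 2 = inv (S n)"
  using guess_Suc[of 1 S n \<pi>] next_guess_no_agreement[OF assms] guess_1[of S n \<pi>]
  by (simp add: numeral_2_eq_2)

lemma guess_3:
  assumes "strategy n S" "n \<ge> 1" "agreement n \<pi> id = {}" "agreement n \<pi> (inv (S n)) = {}"
  shows "guess S n \<pi> 3 = inv (S n) \<circ> inv (S n)"
  using guess_Suc[of 2 S n \<pi>] guess_2[OF assms(1-3)]
    next_guess_no_agreement[OF assms(1,2,4)]
  by (simp add: numeral_3_eq_3 numeral_2_eq_2)

text \<open>The minimality in \<open>first_hit\<close> makes all guesses before \<open>r\<close>
  wrong everywhere. Conversely, \<open>n \<ge> 1\<close> makes full agreement nonempty, so guess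
  \<open>r\<close> counts as a hit and an earlier empty agreement is not a full one.\<close>

lemma ends_after_first_hit_iff:
  assumes "n \<ge> 1"
  shows "ends_after S n \<pi> r \<and> first_hit S n \<pi> = r \<longleftrightarrow>
    1 \<le> r \<and> agreement n \<pi> (guess S n \<pi> r) = {1..n} \<and>
    (\<forall>q. 1 \<le> q \<and> q < r \<longrightarrow> agreement n \<pi> (guess S n \<pi> q) = {})"
    (is "?L \<longleftrightarrow> ?R")
proof
  assume L: ?L
  have "agreement n \<pi> (guess S n \<pi> q) = {}" if "1 \<le> q" "q < r" for q
    using not_less_Least[of q "\<lambda>r. 1 \<le> r \<and> agreement n \<pi> (guess S n \<pi> r) \<noteq> {}"] L that
    by (auto simp: first_hit_def)
  then show ?R
    using L by (simp add: ends_after_def)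
next
  assume R: ?R
  have "first_hit S n \<pi> = r"
    unfolding first_hit_def
  proof (rule Least_equality)
    show "1 \<le> r \<and> agreement n \<pi> (guess S n \<pi> r) \<noteq> {}"
      using R assms by simp
    show "r \<le> q" if "1 \<le> q \<and> agreement n \<pi> (guess S n \<pi> q) \<noteq> {}" for q
      using R that not_le by blast
  qed
  moreover have "{1..n} \<noteq> {}"
    using assms by simp
  ultimately show ?L
    using R by (simp add: ends_after_def)
qed

theorem theorem4p6:
  fixes n :: nat and S :: "nat \<Rightarrow> nat \<Rightarrow> nat"
  assumes "n \<ge> 4" and "cyclic_strategy n S"
  shows "\<exists>!\<pi>. \<pi> permutes {1..n} \<and> ends_after S n \<pi> 3 \<and> first_hit S n \<pi> = 3"
proof -
  have n: "n \<ge> 1" "n \<in> {1..n}"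
    using assms(1) by auto
  have S: "strategy n S" and cyc: "cyclic_on (S n) {1..n}"
    using assms(2) n(2) by (auto simp: cyclic_strategy_def)
  have perm: "S n permutes {1..n}"
    using S n(2) by (auto simp: strategy_def)
  have no_period: "S n (S n i) \<noteq> i" if "i \<in> {1..n}" for i
    using cyclic_on_no_period_two[OF cyc _ that] assms(1) by simp
  have inverse: "S n (inv (S n) i) = i" for i
    using permutes_inverses(1)[OF perm] .
  have hit_iff: "ends_after S n \<pi> 3 \<and> first_hit S n \<pi> = 3 \<longleftrightarrow>
      agreement n \<pi> id = {} \<and> agreement n \<pi> (inv (S n)) = {} \<and>
      agreement n \<pi> (inv (S n) \<circ> inv (S n)) = {1..n}" for \<pi>
  proof -
    have "(\<forall>q. 1 \<le> q \<and> q < 3 \<longrightarrow> P q) \<longleftrightarrow> P 1 \<and> P 2" for P :: "nat \<Rightarrow> bool"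
    proof -
      have "1 \<le> q \<and> q < 3 \<longleftrightarrow> q = 1 \<or> q = 2" for q :: nat
        by auto
      then show ?thesis by auto
    qed
    then have "ends_after S n \<pi> 3 \<and> first_hit S n \<pi> = 3 \<longleftrightarrow>
        agreement n \<pi> (guess S n \<pi> 1) = {} \<and> agreement n \<pi> (guess S n \<pi> 2) = {} \<and>
        agreement n \<pi> (guess S n \<pi> 3) = {1..n}"
      unfolding ends_after_first_hit_iff[OF n(1)] by auto
    \<comment> \<open>The closed form of each guess presupposes that the earlier guesses are wrong
      everywhere; the preceding conjuncts supply exactly this.\<close>
    then show ?thesis
      unfolding guess_1 using guess_2[OF S n(1)] guess_3[OF S n(1)] by metis
  qed
  let ?\<tau> = "inv (S n) \<circ> inv (S n)"
  show ?thesis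
  proof (rule ex1I[of _ ?\<tau>])
    \<comment> \<open>Applying \<open>S n\<close> twice turns \<open>?\<tau> i = i\<close> into
      \<open>S n (S n i) = i\<close>, and turns \<open>?\<tau> i = inv (S n) i\<close> into
      \<open>S n i = i\<close>; both contradict \<open>no_period\<close>.\<close>
    have "?\<tau> i \<noteq> i" "?\<tau> i \<noteq> inv (S n) i" if "i \<in> {1..n}" for i
      using no_period[OF that] inverse[of i] inverse[of "inv (S n) i"] by auto
    then have "agreement n ?\<tau> id = {}" "agreement n ?\<tau> (inv (S n)) = {}"
      unfolding agreement_def by (metis (mono_tags, lifting) empty_Collect_eq id_apply)+
    moreover have "agreement n ?\<tau> ?\<tau> = {1..n}"
      by (auto simp: agreement_def)
    ultimately show "?\<tau> permutes {1..n} \<and> ends_after S n ?\<tau> 3 \<and> first_hit S n ?\<tau> = 3"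
      using hit_iff permutes_compose[OF permutes_inv[OF perm] permutes_inv[OF perm]] by blast
  next
    fix \<pi>
    assume \<pi>: "\<pi> permutes {1..n} \<and> ends_after S n \<pi> 3 \<and> first_hit S n \<pi> = 3"
    then have "agreement n \<pi> ?\<tau> = {1..n}"
      using hit_iff by blast
    then have inside: "\<pi> i = ?\<tau> i" if "i \<in> {1..n}" for i
      using that unfolding agreement_def by (metis (mono_tags, lifting) mem_Collect_eq)
    \<comment> \<open>Agreement only compares entries in \<open>{1..n}\<close>; equality as
      functions also uses that both permutations are the identity elsewhere.\<close>
    have outside: "\<pi> i = ?\<tau> i" if "i \<notin> {1..n}" for i
      using permutes_not_in[OF conjunct1[OF \<pi>] that]
        permutes_not_in[OF permutes_inv[OF perm] that] by simp
    show "\<pi> = ?\<tau>"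
      using inside outside by blast
  qed
qed

end
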